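(* For every $n \in \mathbb{N}$ (i.e. $n\ge 1$), the polynomial identity \[ (-1)^n x^{n-1}=\sum_{m=0}^{n-1}\sum_{k=0}^{n-m-1}C_n(k;2)\binom{m+k}{k}\frac{(2n-m-k-2)!}{(m+k)!\,(n-m-k-1)!}\left(\frac{1}{2}\right)^{n-m-k-1}(x-1)^m \] holds. Moreover, for every integer $m$ with $0 \le m \le n-2$, \[ \sum_{k=0}^{n-m-1}(-1)^k\left(\frac{1}{2}\right)^{n-m-1}\binom{n}{k}\frac{(2n-m-k-2)!}{m!\,(n-m-k-1)!}=0 . \]
   Context: For $a\neq 0$, the Poisson–Charlier polynomials are $C_n(x;a)=\sum_{k=0}^{n}\binom{n}{k}(-1)^{n-k}a^{-k}(x)_k$, where $(x)_k=x(x-1)\cdots(x-k+1)$ (with $(x)_0=1$) is the falling factorial. *)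

theory Defs
  imports Complex_Main "HOL-Computational_Algebra.Polynomial"
begin

definition falling_factorial :: "'a::comm_ring_1 \<Rightarrow> nat \<Rightarrow> 'a" where
  "falling_factorial x k = (\<Prod>i<k. x - of_nat i)"

text \<open>
  The Poisson--Charlier polynomial $C_n(x;a)$ as a polynomial in $x$, the indeterminate being
  \<open>[:0, 1:]\<close>. It is meant for \<open>a \<noteq> 0\<close>.
\<close>

definition charlier :: "nat \<Rightarrow> 'a::field_char_0 \<Rightarrow> 'a poly" where
  "charlier n a = (\<Sum>k=0..n. smult (of_nat (n choose k) * (-1) ^ (n - k) * inverse (a ^ k))
                              (falling_factorial [:0, 1:] k))"

end

(* Collecting the double sum along j = m + k and expanding C_n(k;2) in falling factorials, the
   binomial theorem gives sum_k binom(j,k) (k)_i (x-1)^(j-k) = (j)_i x^(j-i). Hence the coefficient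
   of x^m in the double sum is (-1)^n times the second sum of the theorem, which for m = n-1
   reduces to 1 and for m < n-1 is, up to a factor, an n-th finite difference of the polynomial
   binom(t, n-1) of degree n-1. *)

theory Submission
  imports Defs
begin

text \<open>Pascal's rule splits the left sum in two, and shifting the index in one half leaves a
  first difference of \<open>f\<close>. This is the step that lowers the order of a finite
  difference by one.\<close>

lemma alternating_choose_Suc_sum:
  fixes f :: "nat \<Rightarrow> 'a::comm_ring_1"
  shows "(\<Sum>k\<le>Suc n. (-1) ^ k * of_nat (Suc n choose k) * f k) =
         (\<Sum>k\<le>n. (-1) ^ k * of_nat (n choose k) * (f k - f (Suc k)))"
proof -
  have "(\<Sum>k\<le>Suc n. (-1) ^ k * of_nat (Suc n choose k) * f k) =
        f 0 + (\<Sum>k\<le>n. (-1) ^ Suc k * of_nat (n choose Suc k) * f (Suc k))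
            - (\<Sum>k\<le>n. (-1) ^ k * of_nat (n choose k) * f (Suc k))"
    by (subst sum.atMost_Suc_shift)
       (simp add: sum.distrib sum_negf sum_subtractf algebra_simps)
  also have "f 0 + (\<Sum>k\<le>n. (-1) ^ Suc k * of_nat (n choose Suc k) * f (Suc k)) =
        (\<Sum>k\<le>Suc n. (-1) ^ k * of_nat (n choose k) * f k)"
    by (subst sum.atMost_Suc_shift) simp
  \<comment> \<open>The top term \<open>k = Suc n\<close> drops out because
    \<open>n choose Suc n\<close> is 0.\<close>
  also have "\<dots> = (\<Sum>k\<le>n. (-1) ^ k * of_nat (n choose k) * f k)"
    by (simp add: binomial_eq_0)
  finally show ?thesis
    by (simp add: sum_subtractf algebra_simps)
qed

text \<open>An n-th finite difference kills a polynomial in \<open>k\<close> of degree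
  \<open>r < n\<close>. Each difference lowers \<open>n\<close>, \<open>N\<close> and
  \<open>r\<close> together; \<open>n \<le> N\<close> keeps the truncated subtraction
  \<open>N - k\<close> genuine throughout the sum.\<close>

lemma alternating_choose_choose_sum_eq_0:
  assumes "r < n" "n \<le> N"
  shows "(\<Sum>k\<le>n. (-1) ^ k * of_nat (n choose k) * of_nat ((N - k) choose r)) = (0 :: 'a::comm_ring_1)"
  using assms
proof (induction n arbitrary: N r)
  case (Suc n)
  show ?case
  proof (cases r)
    case 0
    then show ?thesis by (subst alternating_choose_Suc_sum) simp
  next
    case r: (Suc r')
    have "of_nat ((N - k) choose r) - of_nat ((N - Suc k) choose r) =
          (of_nat ((N - 1 - k) choose r') :: 'a)" if "k \<le> n" for k
    proof -
      \<comment> \<open>Since \<open>k < N\<close>, Pascal's rule applies to the upper index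
        \<open>N - k\<close>.\<close>
      have "N - k = Suc (N - Suc k)" using that Suc.prems by simp
      then show ?thesis by (simp add: r)
    qed
    then have "(\<Sum>k\<le>Suc n. (-1) ^ k * of_nat (Suc n choose k) * of_nat ((N - k) choose r)) =
        (\<Sum>k\<le>n. (-1) ^ k * of_nat (n choose k) * (of_nat ((N - 1 - k) choose r') :: 'a))"
      by (subst alternating_choose_Suc_sum) (intro sum.cong; simp)
    also have "\<dots> = 0"
      using Suc.prems r by (intro Suc.IH) auto
    finally show ?thesis .
  qed
qed simp

text \<open>Trinomial revision pulls \<open>j choose i\<close> out of the sum, and the binomial
  theorem in \<open>l = k - i\<close> evaluates the rest. For \<open>i > j\<close> both sides
  vanish.\<close>

lemma choose_choose_power_sum:
  fixes y :: "'a::comm_ring_1"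
  shows "(\<Sum>k\<le>j. of_nat (j choose k) * of_nat (k choose i) * y ^ (j - k)) =
         of_nat (j choose i) * (1 + y) ^ (j - i)"
proof (cases "i \<le> j")
  case True
  have "(\<Sum>k\<le>j. of_nat (j choose k) * of_nat (k choose i) * y ^ (j - k)) =
        (\<Sum>k=i..j. of_nat (j choose k) * of_nat (k choose i) * y ^ (j - k))"
    by (rule sum.mono_neutral_right) (auto simp: binomial_eq_0)
  also have "\<dots> = (\<Sum>k=i..j. of_nat (j choose i) * (of_nat ((j - i) choose (k - i)) * y ^ (j - k)))"
  proof (intro sum.cong refl)
    fix k assume "k \<in> {i..j}"
    then have "(j choose k) * (k choose i) = (j choose i) * ((j - i) choose (k - i))"
      by (simp add: choose_mult)
    then show "of_nat (j choose k) * of_nat (k choose i) * y ^ (j - k) =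
        of_nat (j choose i) * (of_nat ((j - i) choose (k - i)) * y ^ (j - k))"
      by (metis mult.assoc of_nat_mult)
  qed
  also have "\<dots> = of_nat (j choose i) * (\<Sum>k=i..j. of_nat ((j - i) choose (k - i)) * y ^ (j - k))"
    by (simp add: sum_distrib_left)
  also have "(\<Sum>k=i..j. of_nat ((j - i) choose (k - i)) * y ^ (j - k)) =
        (\<Sum>l\<le>j - i. of_nat ((j - i) choose l) * 1 ^ l * y ^ (j - i - l))"
    using True by (intro sum.reindex_bij_witness[of _ "\<lambda>l. l + i" "\<lambda>k. k - i"]) auto
  also have "\<dots> = (1 + y) ^ (j - i)"
    by (rule binomial_ring[symmetric])
  finally show ?thesis .
qed (auto intro!: sum.neutral simp: binomial_eq_0)

text \<open>Regroups by \<open>j = m + k\<close>. With \<open>n = 0\<close> the left side would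
  still contain the term \<open>g 0 0\<close>, hence the assumption.\<close>

lemma sum_triangle_antidiagonals:
  fixes g :: "nat \<Rightarrow> nat \<Rightarrow> 'a::comm_monoid_add"
  assumes "n \<ge> 1"
  shows "(\<Sum>m=0..n-1. \<Sum>k=0..n-m-1. g m k) = (\<Sum>j<n. \<Sum>k\<le>j. g (j - k) k)"
  unfolding sum.Sigma[OF finite_atLeastAtMost ballI[OF finite_atLeastAtMost]]
    sum.Sigma[OF finite_lessThan ballI[OF finite_atMost]]
  using assms
  by (intro sum.reindex_bij_witness[of _ "\<lambda>(j, k). (j - k, k)" "\<lambda>(m, k). (m + k, k)"]) auto

lemma falling_factorial_of_nat:
  "falling_factorial (of_nat k :: 'a::field_char_0) i = fact i * of_nat (k choose i)"
  by (simp add: falling_factorial_def binomial_gbinomial gbinomial_prod_rev atLeast0LessThan)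

lemma poly_charlier_of_nat:
  "poly (charlier n a) (of_nat k) =
     (\<Sum>i\<le>n. of_nat (n choose i) * (-1) ^ (n - i) * inverse (a ^ i) * fact i * of_nat (k choose i))"
proof -
  have "poly (falling_factorial [:0, 1:] i) x = falling_factorial x i" for i and x :: 'a
    by (simp add: falling_factorial_def poly_prod)
  then show ?thesis
    by (simp add: charlier_def poly_sum falling_factorial_of_nat atMost_atLeast0 mult.assoc)
qed

lemma smult_sum_right: "smult c (\<Sum>i\<in>S. f i) = (\<Sum>i\<in>S. smult c (f i))"
  by (induction S rule: infinite_finite_induct) (auto simp: smult_add_right)

text \<open>Trades powers of x-1 for powers of x: after exchanging the sums, the sum over
  \<open>k\<close> for fixed \<open>i\<close> is \<open>choose_choose_power_sum\<close> with
  \<open>y\<close> = x-1, so that 1 + y = x.\<close>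

lemma charlier_binomial_sum:
  fixes a :: "'a::field_char_0"
  assumes "j \<le> n"
  shows "(\<Sum>k\<le>j. smult (poly (charlier n a) (of_nat k) * of_nat (j choose k)) ([:-1, 1:] ^ (j - k))) =
         (\<Sum>i\<le>j. smult (of_nat (n choose i) * (-1) ^ (n - i) * inverse (a ^ i) * fact i * of_nat (j choose i))
                        ([:0, 1:] ^ (j - i)))"
proof -
  define b where "b i = of_nat (n choose i) * (-1) ^ (n - i) * inverse (a ^ i) * fact i" for i
  let ?y = "[:-1, 1:] :: 'a poly"
  have "(\<Sum>k\<le>j. smult (poly (charlier n a) (of_nat k) * of_nat (j choose k)) (?y ^ (j - k))) =
        (\<Sum>k\<le>j. \<Sum>i\<le>n. smult (b i) (of_nat (j choose k) * of_nat (k choose i) * ?y ^ (j - k)))"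
    by (intro sum.cong refl)
       (simp add: poly_charlier_of_nat b_def sum_distrib_right sum_distrib_left smult_sum of_nat_poly mult_ac)
  also have "\<dots> = (\<Sum>i\<le>n. smult (b i) (\<Sum>k\<le>j. of_nat (j choose k) * of_nat (k choose i) * ?y ^ (j - k)))"
    by (subst sum.swap) (simp add: smult_sum_right)
  also have "\<dots> = (\<Sum>i\<le>n. smult (b i * of_nat (j choose i)) ([:0, 1:] ^ (j - i)))"
    unfolding choose_choose_power_sum by (simp add: one_pCons of_nat_poly)
  \<comment> \<open>Terms with \<open>i > j\<close> vanish, and \<open>j \<le> n\<close> makes every
    \<open>i \<le> j\<close> occur.\<close>
  also have "\<dots> = (\<Sum>i\<le>j. smult (b i * of_nat (j choose i)) ([:0, 1:] ^ (j - i)))"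
    using assms by (intro sum.mono_neutral_right) auto
  finally show ?thesis by (simp add: b_def)
qed

text \<open>The factorial quotient is a factor free of \<open>k\<close> times a binomial coefficient
  with lower index \<open>n - 1\<close>, so the preceding vanishing result applies with
  \<open>N = 2*n - m - 2\<close>; its condition \<open>n \<le> N\<close> amounts to
  \<open>m + 2 \<le> n\<close>. The constant \<open>c\<close> stands for the power of 1/2.\<close>

lemma alternating_choose_fact_sum_eq_0:
  assumes "m + 2 \<le> n"
  shows "(\<Sum>k=0..n-m-1. (-1) ^ k * c * of_nat (n choose k)
            * (fact (2*n - m - k - 2) / (fact m * fact (n - m - k - 1)))) = (0 :: 'a::field_char_0)"
proof -
  have "(\<Sum>k=0..n-m-1. (-1) ^ k * c * of_nat (n choose k)
            * (fact (2*n - m - k - 2) / (fact m * fact (n - m - k - 1)))) =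
        (\<Sum>k=0..n-m-1. c * fact (n - 1) / fact m *
            ((-1) ^ k * of_nat (n choose k) * of_nat ((2*n - m - 2 - k) choose (n - 1))))"
  proof (intro sum.cong refl)
    fix k assume "k \<in> {0..n-m-1}"
    then have "n - 1 \<le> 2*n - m - k - 2" "2*n - m - k - 2 - (n - 1) = n - m - k - 1"
      "2*n - m - 2 - k = 2*n - m - k - 2"
      using assms by auto
    then show "(-1) ^ k * c * of_nat (n choose k)
            * (fact (2*n - m - k - 2) / (fact m * fact (n - m - k - 1))) = c * fact (n - 1) / fact m *
            ((-1) ^ k * of_nat (n choose k) * of_nat ((2*n - m - 2 - k) choose (n - 1)))"
      by (simp add: binomial_fact)
  qed
  also have "\<dots> = c * fact (n - 1) / fact m *
      (\<Sum>k=0..n-m-1. (-1) ^ k * of_nat (n choose k) * of_nat ((2*n - m - 2 - k) choose (n - 1)))"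
    by (simp add: sum_distrib_left)
  also have "(\<Sum>k=0..n-m-1. (-1) ^ k * of_nat (n choose k) * of_nat ((2*n - m - 2 - k) choose (n - 1))) =
      (\<Sum>k\<le>n. (-1) ^ k * of_nat (n choose k) * (of_nat ((2*n - m - 2 - k) choose (n - 1)) :: 'a))"
    \<comment> \<open>For \<open>k \<ge> n - m\<close> the upper index is below
      \<open>n - 1\<close>, so the added terms are 0.\<close>
    using assms by (intro sum.mono_neutral_left) (auto simp: binomial_eq_0_iff)
  also have "\<dots> = 0"
    using assms by (intro alternating_choose_choose_sum_eq_0) auto
  finally show ?thesis by simp
qed

theorem theorem1:
  fixes n :: nat
  assumes "n \<ge> 1"
  shows "(-1) ^ n * [:0, 1:] ^ (n - 1) =
           (\<Sum>m=0..n-1. \<Sum>k=0..n-m-1.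
              smult (poly (charlier n 2) (of_nat k) * of_nat ((m + k) choose k)
                       * (fact (2*n - m - k - 2) / (fact (m + k) * fact (n - m - k - 1)))
                       * (1/2) ^ (n - m - k - 1))
                    ([:-1, 1:] ^ m :: 'a::field_char_0 poly))
       \<and> (\<forall>m. m + 2 \<le> n \<longrightarrow>
           (\<Sum>k=0..n-m-1. (-1) ^ k * (1/2) ^ (n - m - 1) * of_nat (n choose k)
              * (fact (2*n - m - k - 2) / (fact m * fact (n - m - k - 1)))) = (0 :: 'a))"
    (is "_ = ?rhs \<and> (\<forall>m. _ \<longrightarrow> ?S m = 0)")
proof
  show vanish: "\<forall>m. m + 2 \<le> n \<longrightarrow> ?S m = 0"
    using alternating_choose_fact_sum_eq_0 by blast
  \<comment> \<open>\<open>w\<close> gathers the factors depending on \<open>m\<close> and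
    \<open>k\<close> only through \<open>j = m + k\<close>; \<open>b\<close> holds the coefficients
    from \<open>charlier_binomial_sum\<close> at \<open>a = 2\<close>.\<close>
  define w :: "nat \<Rightarrow> 'a" where
    "w j = fact (2*n - j - 2) / (fact j * fact (n - j - 1)) * (1/2) ^ (n - j - 1)" for j
  define b :: "nat \<Rightarrow> nat \<Rightarrow> 'a" where
    "b j i = of_nat (n choose i) * (-1) ^ (n - i) * inverse (2 ^ i) * fact i * of_nat (j choose i)" for j i
  have "?rhs = (\<Sum>j<n. \<Sum>k\<le>j. smult (w j)
      (smult (poly (charlier n 2) (of_nat k) * of_nat (j choose k)) ([:-1, 1:] ^ (j - k))))"
    by (subst sum_triangle_antidiagonals[OF assms]) (intro sum.cong refl; simp add: w_def mult_ac)
  also have "\<dots> = (\<Sum>j<n. \<Sum>i\<le>j. smult (w j) (smult (b j i) ([:0, 1:] ^ (j - i))))"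
    unfolding smult_sum_right[symmetric] b_def
    by (intro sum.cong refl arg_cong[where f = "smult _"] charlier_binomial_sum) auto
  \<comment> \<open>The regrouping is now undone with \<open>m = j - i\<close>, the exponent of x,
    which collects the coefficient of each power of x.\<close>
  also have "\<dots> = (\<Sum>m=0..n-1. \<Sum>i=0..n-m-1. smult (w (m + i)) (smult (b (m + i) i) ([:0, 1:] ^ m)))"
    by (subst sum_triangle_antidiagonals[OF assms]) simp
  also have "\<dots> = (\<Sum>m=0..n-1. smult (\<Sum>i=0..n-m-1. w (m + i) * b (m + i) i) ([:0, 1:] ^ m))"
    by (simp add: smult_sum)
  also have "\<dots> = (\<Sum>m=0..n-1. smult ((-1) ^ n * ?S m) ([:0, 1:] ^ m))"
  proof (intro sum.cong refl arg_cong2[where f = smult])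
    fix m assume m: "m \<in> {0..n-1}"
    show "(\<Sum>i=0..n-m-1. w (m + i) * b (m + i) i) = (-1) ^ n * ?S m"
      unfolding sum_distrib_left
    proof (intro sum.cong refl)
      fix i assume "i \<in> {0..n-m-1}"
      then have i: "i \<le> n" "i \<le> n - m - 1" by auto
      have "(-1 :: 'a) ^ n = (-1) ^ (n - i) * (-1) ^ i"
        using i(1) by (simp flip: power_add)
      then have sign: "(-1) ^ (n - i) = (-1) ^ n * (-1 :: 'a) ^ i"
        by (simp add: mult.assoc)
      \<comment> \<open>The factor \<open>inverse (2 ^ i)\<close> from the Charlier coefficients
        completes the power of 1/2 to one independent of \<open>i\<close>.\<close>
      have "n - m - 1 = n - m - i - 1 + i"
        using i(2) by simp
      then have "(1/2 :: 'a) ^ (n - m - 1) = (1/2) ^ (n - m - i - 1) * (1/2) ^ i"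
        by (metis power_add)
      then have half: "(1/2 :: 'a) ^ (n - m - 1) = (1/2) ^ (n - m - i - 1) * inverse (2 ^ i)"
        by (simp add: power_one_over inverse_eq_divide)
      have "fact i * of_nat ((m + i) choose i) = (fact (m + i) / fact m :: 'a)"
        by (simp add: binomial_fact)
      then have "w (m + i) * b (m + i) i =
          w (m + i) * (of_nat (n choose i) * (-1) ^ (n - i) * inverse (2 ^ i) * (fact (m + i) / fact m))"
        by (simp add: b_def mult.assoc)
      also have "\<dots> = (-1) ^ n * ((-1) ^ i * (1/2) ^ (n - m - 1) * of_nat (n choose i)
              * (fact (2*n - m - i - 2) / (fact m * fact (n - m - i - 1))))"
        unfolding sign half w_def by (simp add: diff_diff_left field_simps)
      finally show "w (m + i) * b (m + i) i = \<dots>" .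
    qed
  qed
  also have "\<dots> = (\<Sum>m\<in>{n-1}. smult ((-1) ^ n * ?S m) ([:0, 1:] ^ m))"
  proof (intro sum.mono_neutral_right ballI)
    fix m assume "m \<in> {0..n-1} - {n-1}"
    then have "m + 2 \<le> n" by auto
    then have "?S m = 0" using vanish by blast
    then show "smult ((-1) ^ n * ?S m) ([:0, 1:] ^ m) = 0" by (simp only: mult_zero_right smult_0_left)
  qed auto
  also have "\<dots> = smult ((-1) ^ n) ([:0, 1:] ^ (n - 1))"
  proof -
    \<comment> \<open>At \<open>m = n - 1\<close> only \<open>k = 0\<close> remains, and its
      factorial quotient is 1.\<close>
    have "2 * n - (n - 1) - 2 = n - 1" using assms by simp
    then show ?thesis using assms by simp
  qed
  also have "\<dots> = (-1) ^ n * [:0, 1:] ^ (n - 1)"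
    by (cases "even n") auto
  finally show "(-1) ^ n * [:0, 1:] ^ (n - 1) = ?rhs" ..
qed

end
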